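(* Let $a\ge b\ge 2$ and $d\ge0$ be integers. Then $r_\alpha-r_\beta=s_{ab1^d}$ for each of the following pairs $(\alpha,\beta)$: (1) $\alpha=(b,1^d,a)$, $\beta=(b-1,1^d,a+1)$; (2) $\alpha=(a,b,1^d)$, $\beta=(b-1,a+1,1^d)$; (3) $\alpha=(1^{d+1},a,b-1)$, $\beta=(1^{d+1},b-1,a)$; (4) $\alpha=(1,a,1^d,b-1)$, $\beta=(1,b-1,1^d,a)$; (5) $\alpha=(b-1,1^d,b,a-b+1)$, $\beta=(b,1^d,b-1,a-b+1)$.
   Context: A composition is a finite sequence of positive integers; $j^m$ denotes $m$ consecutive parts equal to $j$. $ab1^d$ denotes the partition $(a,b,1,\dots,1)$ with $d$ ones. The ribbon diagram of $\alpha=\alpha_1\cdots\alpha_R$ (English convention, rows from the top) has $\alpha_i$ cells in row $i$, with the rightmost cell of row $i+1$ directly below the leftmost cell of row $i$; $r_\alpha=\sum_T\prod_m x_m^{\#\{m\text{'s in }T\}}$ over semistandard Young tableaux $T$ of this shape (rows weakly increasing, columns strictly increasing). $s_\nu$ is the Schur function. *)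

theory Defs
  imports Complex_Main "HOL-Library.FuncSet" "HOL-Library.Poly_Mapping"
begin

text \<open>Cells are pairs (row, column), both counted from 0, rows from the top and columns from the
  left.\<close>

type_synonym cell = "nat \<times> nat"

definition partition_diagram :: "nat list \<Rightarrow> cell set" where
  "partition_diagram \<nu> = {(i, j). i < length \<nu> \<and> j < \<nu> ! i}"

text \<open>The column of the leftmost cell of row i, normalised so that the bottom row of the ribbon
  starts in column 0. That the rightmost cell of row i + 1 lies below this cell is
  lemma \<open>ribbon_overlap\<close>.\<close>

definition ribbon_left :: "nat list \<Rightarrow> nat \<Rightarrow> nat" where
  "ribbon_left \<alpha> i = (\<Sum>k\<in>{i<..<length \<alpha>}. \<alpha> ! k - 1)"

definition ribbon_diagram :: "nat list \<Rightarrow> cell set" where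
  "ribbon_diagram \<alpha> =
    {(i, j). i < length \<alpha> \<and> ribbon_left \<alpha> i \<le> j \<and> j < ribbon_left \<alpha> i + \<alpha> ! i}"

text \<open>Fillings are made extensional so that tableaux agreeing on the diagram are equal.\<close>

definition ssyt :: "cell set \<Rightarrow> (cell \<Rightarrow> nat) set" where
  "ssyt D = {T \<in> D \<rightarrow>\<^sub>E {1..}.
     (\<forall>i j j'. (i, j) \<in> D \<longrightarrow> (i, j') \<in> D \<longrightarrow> j < j' \<longrightarrow> T (i, j) \<le> T (i, j')) \<and>
     (\<forall>i i' j. (i, j) \<in> D \<longrightarrow> (i', j) \<in> D \<longrightarrow> i < i' \<longrightarrow> T (i, j) < T (i', j))}"

text \<open>A formal power series over the integers in infinitely many variables is given by its
  coefficients; the monomial \<open>\<Prod>m. x\<^sub>m ^ \<mu> m\<close> is represented by its exponent vector \<open>\<mu>\<close>.\<close>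

type_synonym power_series = "(nat \<Rightarrow>\<^sub>0 nat) \<Rightarrow> int"

definition ssyt_of_weight :: "cell set \<Rightarrow> (nat \<Rightarrow>\<^sub>0 nat) \<Rightarrow> (cell \<Rightarrow> nat) set" where
  "ssyt_of_weight D \<mu> =
    {T \<in> ssyt D. \<forall>m. Poly_Mapping.lookup \<mu> m = card {c \<in> D. T c = m}}"

text \<open>The generating function \<open>\<Sum>T. \<Prod>m. x\<^sub>m ^ #{m's in T}\<close>. For finite \<open>D\<close>
  the cardinality is that of a finite set, see \<open>finite_ssyt_of_weight\<close>.\<close>

definition tableau_series :: "cell set \<Rightarrow> power_series" where
  "tableau_series D = (\<lambda>\<mu>. int (card (ssyt_of_weight D \<mu>)))"

definition ribbon_schur :: "nat list \<Rightarrow> power_series" where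
  "ribbon_schur \<alpha> = tableau_series (ribbon_diagram \<alpha>)"

definition schur :: "nat list \<Rightarrow> power_series" where
  "schur \<nu> = tableau_series (partition_diagram \<nu>)"

lemma ribbon_overlap:
  assumes "Suc i < length \<alpha>" and "\<alpha> ! Suc i > 0"
  shows "ribbon_left \<alpha> (Suc i) + \<alpha> ! Suc i - 1 = ribbon_left \<alpha> i"
proof -
  have "{i<..<length \<alpha>} = insert (Suc i) {Suc i<..<length \<alpha>}"
    using assms(1) by auto
  then show ?thesis
    using assms(2) by (simp add: ribbon_left_def)
qed

lemma finite_partition_diagram: "finite (partition_diagram \<nu>)"
proof -
  have "partition_diagram \<nu> = (SIGMA i:{..<length \<nu>}. {..<\<nu> ! i})"
    by (auto simp: partition_diagram_def)
  then show ?thesis by simp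
qed

lemma finite_ribbon_diagram: "finite (ribbon_diagram \<alpha>)"
proof -
  have "ribbon_diagram \<alpha> =
      (SIGMA i:{..<length \<alpha>}. {ribbon_left \<alpha> i..<ribbon_left \<alpha> i + \<alpha> ! i})"
    by (auto simp: ribbon_diagram_def)
  then show ?thesis by simp
qed

lemma finite_ssyt_of_weight:
  assumes "finite D"
  shows "finite (ssyt_of_weight D \<mu>)"
proof (rule finite_subset)
  show "ssyt_of_weight D \<mu> \<subseteq> D \<rightarrow>\<^sub>E Poly_Mapping.keys \<mu>"
  proof
    fix T assume T: "T \<in> ssyt_of_weight D \<mu>"
    have "T c \<in> Poly_Mapping.keys \<mu>" if "c \<in> D" for c
    proof -
      have "c \<in> {c' \<in> D. T c' = T c}"
        using that by simp
      moreover have "finite {c' \<in> D. T c' = T c}"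
        using assms by simp
      ultimately have "card {c' \<in> D. T c' = T c} \<noteq> 0"
        by (metis card_eq_0_iff empty_iff)
      then show ?thesis
        using T by (simp add: ssyt_of_weight_def in_keys_iff)
    qed
    then show "T \<in> D \<rightarrow>\<^sub>E Poly_Mapping.keys \<mu>"
      using T by (auto simp: ssyt_of_weight_def ssyt_def PiE_iff)
  qed
  show "finite (D \<rightarrow>\<^sub>E Poly_Mapping.keys \<mu>)"
    using assms by (intro finite_PiE) auto
qed

end

theory Submission
  imports Defs
begin

text \<open>Read a ribbon from its bottom row to its top row, each row from left to right: a tableau becomes
  a word whose descents occur exactly at the row changes. Splitting a word in two, with either a
  descent or a weak ascent at the cut, gives \<open>r\<^sub>\<alpha> r\<^sub>\<beta> = r\<^bsub>\<alpha>\<cdot>\<beta>\<^esub> + r\<^bsub>\<alpha>\<odot>\<beta>\<^esub>\<close> for concatenation and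
  near-concatenation, and hence \<open>r\<^sub>\<alpha> = r\<close> of the reversed composition. With \<open>h\<^sub>m\<close> the series of a
  row, these rules reduce all five differences to
  \<open>h\<^sub>a r\<^bsub>(b,1^d)\<^esub> - h\<^bsub>b-1\<^esub> r\<^bsub>(a+1,1^d)\<^esub>\<close>. That this is \<open>s\<^bsub>ab1^d\<^esub>\<close> follows by swapping tails: place a row of
  length \<open>a\<close> on top of a hook \<open>(b,1^d)\<close>; if some column fails to increase strictly, exchange the two
  rows beyond the first such column.

  Fixing a monomial restricts the entries to a finite alphabet, so that the computation takes place in
  a commutative ring of polynomials.\<close>

section \<open>Words with prescribed descents\<close>

definition step :: "bool \<Rightarrow> nat \<Rightarrow> nat \<Rightarrow> bool" where
  "step b y z \<longleftrightarrow> (if b then z < y else y \<le> z)"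

text \<open>In a pattern, \<open>True\<close> prescribes a descent and \<open>False\<close> a weak ascent.\<close>

definition fits :: "bool list \<Rightarrow> (nat \<Rightarrow> nat) \<Rightarrow> bool" where
  "fits bs f \<longleftrightarrow> (\<forall>p<length bs. step (bs ! p) (f p) (f (Suc p)))"

definition words :: "nat set \<Rightarrow> nat \<Rightarrow> ((nat \<Rightarrow> nat) \<Rightarrow> bool) \<Rightarrow> nat list set" where
  "words K n Q = {w. length w = n \<and> set w \<subseteq> K \<and> Q ((!) w)}"

text \<open>This is the ribbon Schur function over the alphabet \<open>K\<close>, with
  \<open>x m\<close> in place of the variable with index \<open>m\<close>. A pattern of
  \<open>n\<close> steps governs words of \<open>n + 1\<close> letters, so \<open>[]\<close> stands
  for a single cell.\<close>

definition pattern_sum :: "nat set \<Rightarrow> (nat \<Rightarrow> 'r::comm_ring_1) \<Rightarrow> bool list \<Rightarrow> 'r" where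
  "pattern_sum K x bs = (\<Sum>w\<in>words K (Suc (length bs)) (fits bs). prod_list (map x w))"

lemma fits_cong:
  assumes "\<And>p. p \<le> length bs \<Longrightarrow> f p = g p"
  shows "fits bs f \<longleftrightarrow> fits bs g"
  using assms by (simp add: fits_def)

lemma fits_append_Cons:
  "fits (u @ b # v) f \<longleftrightarrow>
     fits u f \<and> step b (f (length u)) (f (Suc (length u))) \<and> fits v (\<lambda>p. f (Suc (length u) + p))"
proof -
  let ?n = "length u"
  have split: "(\<forall>p < Suc (?n + length v). R p) \<longleftrightarrow>
      (\<forall>p < ?n. R p) \<and> R ?n \<and> (\<forall>p < length v. R (Suc (?n + p)))" for R
  proof (intro iffI allI impI conjI)
    fix p
    assume R: "(\<forall>p < ?n. R p) \<and> R ?n \<and> (\<forall>p < length v. R (Suc (?n + p)))"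
      and p: "p < Suc (?n + length v)"
    show "R p"
    proof (cases "p \<le> ?n")
      case True
      then show ?thesis using R by (cases "p = ?n") auto
    next
      case False
      then obtain q where "p = Suc (?n + q)"
        using less_imp_Suc_add not_le by blast
      then show ?thesis using R p by auto
    qed
  qed auto
  show ?thesis
    unfolding fits_def by (simp add: split nth_append)
qed

lemma fits_replicate_False:
  "fits (replicate n False) f \<longleftrightarrow> (\<forall>p<n. f p \<le> f (Suc p))"
  by (simp add: fits_def step_def)

lemma fits_hook:
  "fits (replicate d True @ replicate n False) f \<longleftrightarrow>
     (\<forall>p<d + n. if p < d then f (Suc p) < f p else f p \<le> f (Suc p))"
proof -
  have "(replicate d True @ replicate n False) ! p \<longleftrightarrow> p < d" if "p < d + n" for p
    using that by (simp add: nth_append)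
  then show ?thesis
    by (simp add: fits_def step_def)
qed

lemma finite_words: "finite K \<Longrightarrow> finite (words K n Q)"
  by (rule finite_subset[OF _ finite_lists_length_eq[of K n]]) (auto simp: words_def)

lemma inj_on_append_pairs:
  "inj_on (\<lambda>(u, v). u @ v) {(u, v). length u = m \<and> length v = n \<and> R u v}"
  by (rule inj_onI) (clarsimp split: prod.splits)

lemma words_append:
  "(\<lambda>(u, v). u @ v) `
      {(u, v). length u = m \<and> length v = n \<and> set u \<subseteq> K \<and> set v \<subseteq> K \<and> Q ((!) (u @ v))} =
    words K (m + n) Q" (is "?f ` ?P = _")
proof (intro equalityI subsetI)
  fix w assume w: "w \<in> words K (m + n) Q"
  have "(take m w, drop m w) \<in> ?P"
    using w by (simp add: words_def order.trans[OF set_take_subset] order.trans[OF set_drop_subset])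
  then have "take m w @ drop m w \<in> ?f ` ?P"
    by (metis (no_types, lifting) case_prod_conv image_eqI)
  then show "w \<in> ?f ` ?P"
    by (simp only: append_take_drop_id)
next
  fix w assume "w \<in> ?f ` ?P"
  then show "w \<in> words K (m + n) Q"
    by (elim imageE) (auto simp: words_def)
qed

text \<open>Serves both the product rule and, later, the splitting of a tableau into its top row and
  the hook below it.\<close>

lemma sum_words_append:
  fixes x :: "nat \<Rightarrow> 'r::comm_ring_1"
  shows "(\<Sum>w\<in>words K (m + n) Q. prod_list (map x w)) =
    (\<Sum>(u, v)\<in>{(u, v). length u = m \<and> length v = n \<and> set u \<subseteq> K \<and> set v \<subseteq> K \<and> Q ((!) (u @ v))}.
      prod_list (map x u) * prod_list (map x v))"
  unfolding words_append[symmetric] sum.reindex[OF inj_on_append_pairs]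
  by (rule sum.cong) auto

text \<open>Two words are joined by either a descent or a weak ascent, never both, so concatenation
  sorts all pairs into the two longer patterns.\<close>

lemma pattern_sum_mult:
  fixes x :: "nat \<Rightarrow> 'r::comm_ring_1"
  assumes "finite K"
  shows "pattern_sum K x u * pattern_sum K x v =
    pattern_sum K x (u @ True # v) + pattern_sum K x (u @ False # v)"
proof -
  let ?W = "\<lambda>bs. words K (Suc (length bs)) (fits bs)"
  let ?wt = "\<lambda>(w, w'). prod_list (map x w) * prod_list (map x w')"
  define S where "S b = {(w, w'). (w, w') \<in> ?W u \<times> ?W v \<and> step b (last w) (hd w')}" for b
  have fits_iff: "fits (u @ b # v) ((!) (w @ w')) \<longleftrightarrow>
      fits u ((!) w) \<and> step b (last w) (hd w') \<and> fits v ((!) w')"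
    if l: "length w = Suc (length u)" "length w' = Suc (length v)" for w w' b
  proof -
    have "fits u ((!) (w @ w')) = fits u ((!) w)"
      by (rule fits_cong) (simp add: nth_append l)
    moreover have "fits v (\<lambda>p. (w @ w') ! (Suc (length u) + p)) = fits v ((!) w')"
      by (rule fits_cong) (simp add: nth_append l)
    moreover have "last w = w ! length u" "hd w' = w' ! 0"
      using l by (auto simp: last_conv_nth hd_conv_nth simp flip: length_0_conv)
    ultimately show ?thesis
      using l by (simp add: fits_append_Cons nth_append)
  qed
  have S: "pattern_sum K x (u @ b # v) = sum ?wt (S b)" for b
  proof -
    have "pattern_sum K x (u @ b # v) =
        (\<Sum>w\<in>words K (Suc (length u) + Suc (length v)) (fits (u @ b # v)). prod_list (map x w))"
      by (simp add: pattern_sum_def)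
    also have "\<dots> = sum ?wt (S b)"
      unfolding sum_words_append
      by (rule sum.cong) (auto simp: S_def words_def fits_iff)
    finally show ?thesis .
  qed
  have fin: "finite (?W u \<times> ?W v)"
    using assms by (simp add: finite_words)
  have "pattern_sum K x u * pattern_sum K x v = sum ?wt (?W u \<times> ?W v)"
    by (simp add: pattern_sum_def sum_product sum.cartesian_product)
  also have "?W u \<times> ?W v = S True \<union> S False"
    by (auto simp: S_def step_def)
  also have "sum ?wt \<dots> = sum ?wt (S True) + sum ?wt (S False)"
    by (rule sum.union_disjoint; (rule finite_subset[OF _ fin])?) (auto simp: S_def step_def)
  finally show ?thesis
    by (simp add: S)
qed

text \<open>Induction on the number of descents: the product rule trades a descent for an ascent and two
  shorter patterns, and a pattern without descents is a palindrome.\<close>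

lemma pattern_sum_rev:
  assumes "finite K"
  shows "pattern_sum K x (rev bs) = pattern_sum K x bs"
proof (induction "count_list bs True" arbitrary: bs rule: less_induct)
  case less
  show ?case
  proof (cases "True \<in> set bs")
    case False
    then have "bs = replicate (length bs) False"
      by (metis (full_types) replicate_eqI)
    then show ?thesis by (metis rev_replicate)
  next
    case True
    then obtain u v where bs: "bs = u @ True # v"
      by (meson split_list)
    have "pattern_sum K x (rev u) = pattern_sum K x u"
      "pattern_sum K x (rev v) = pattern_sum K x v"
      "pattern_sum K x (rev (u @ False # v)) = pattern_sum K x (u @ False # v)"
      by (rule less; simp add: bs)+
    \<comment> \<open>Both products are equal by commutativity and the induction hypothesis, and
      their \<open>False\<close> terms agree by induction; hence so do the \<open>True\<close>
      terms.\<close>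
    with pattern_sum_mult[OF assms, of x u v] pattern_sum_mult[OF assms, of x "rev v" "rev u"]
    show ?thesis
      by (simp add: bs mult.commute)
  qed
qed

section \<open>From tableaux to words\<close>

text \<open>The order conditions of \<open>ssyt\<close> are separated from its typing condition, so
  that they apply to any function on cells, in particular to one read off from a word.\<close>

definition semistandard :: "cell set \<Rightarrow> (cell \<Rightarrow> nat) \<Rightarrow> bool" where
  "semistandard D T \<longleftrightarrow>
     (\<forall>i j j'. (i, j) \<in> D \<longrightarrow> (i, j') \<in> D \<longrightarrow> j < j' \<longrightarrow> T (i, j) \<le> T (i, j')) \<and>
     (\<forall>i i' j. (i, j) \<in> D \<longrightarrow> (i', j) \<in> D \<longrightarrow> i < i' \<longrightarrow> T (i, j) < T (i', j))"

lemma ssyt_iff: "T \<in> ssyt D \<longleftrightarrow> T \<in> D \<rightarrow>\<^sub>E {1..} \<and> semistandard D T"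
  by (simp add: ssyt_def semistandard_def)

lemma semistandard_cong:
  assumes "\<And>c. c \<in> D \<Longrightarrow> T c = T' c"
  shows "semistandard D T \<longleftrightarrow> semistandard D T'"
proof -
  have "semistandard D T'" if "semistandard D T" "\<And>c. c \<in> D \<Longrightarrow> T c = T' c" for T T'
    using that(1) unfolding semistandard_def by (simp flip: that(2))
  then show ?thesis
    using assms by metis
qed

text \<open>A truncated and evaluated generating function: for finite \<open>K\<close> and
  \<open>D\<close> it is a finite sum in a ring, unlike \<open>tableau_series\<close>.\<close>

definition tableau_sum :: "nat set \<Rightarrow> (nat \<Rightarrow> 'r::comm_ring_1) \<Rightarrow> cell set \<Rightarrow> 'r" where
  "tableau_sum K x D = (\<Sum>T\<in>{T \<in> D \<rightarrow>\<^sub>E K. semistandard D T}. \<Prod>c\<in>D. x (T c))"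

lemma prod_list_map_nth: "prod_list (map x w) = (\<Prod>p<length w. x (w ! p))"
  by (induction w rule: rev_induct) (simp_all add: nth_append)

text \<open>Numbering the cells turns fillings into words, with \<open>inv_into D pos\<close> as the
  way back. The order condition only has to be translated for functions of the cell number.\<close>

lemma tableau_sum_words:
  fixes x :: "nat \<Rightarrow> 'r::comm_ring_1"
  assumes pos: "bij_betw pos D {..<n}"
    and Q: "\<And>f. semistandard D (\<lambda>c. f (pos c)) \<longleftrightarrow> Q f"
  shows "tableau_sum K x D = (\<Sum>w\<in>words K n Q. prod_list (map x w))"
  unfolding tableau_sum_def
proof (rule sum.reindex_bij_witness[of _ "\<lambda>w. \<lambda>c\<in>D. w ! pos c"
      "\<lambda>T. map (\<lambda>p. T (inv_into D pos p)) [0..<n]"])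
  have inv: "pos c < n \<and> inv_into D pos (pos c) = c" if "c \<in> D" for c
    using pos that by (auto simp: bij_betw_def)
  have inv': "inv_into D pos p \<in> D \<and> pos (inv_into D pos p) = p" if "p < n" for p
    using pos that by (auto simp: bij_betw_def inv_into_into f_inv_into_f)
  {
    fix T assume T: "T \<in> {T \<in> D \<rightarrow>\<^sub>E K. semistandard D T}"
    let ?w = "map (\<lambda>p. T (inv_into D pos p)) [0..<n]"
    have w: "?w ! pos c = T c" if "c \<in> D" for c
      using inv[OF that] by simp
    show "(\<lambda>c\<in>D. ?w ! pos c) = T"
      using T w by (intro ext) (auto simp: PiE_iff extensional_def restrict_def)
    have "semistandard D (\<lambda>c. ?w ! pos c) \<longleftrightarrow> semistandard D T"
      by (rule semistandard_cong) (rule w)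
    then have "Q ((!) ?w)"
      using T Q by simp
    then show "?w \<in> words K n Q"
      using T inv' by (auto simp: words_def)
    have "prod_list (map x ?w) = (\<Prod>p<n. x (?w ! p))"
      by (simp add: prod_list_map_nth)
    also have "\<dots> = (\<Prod>c\<in>D. x (?w ! pos c))"
      by (rule prod.reindex_bij_betw[OF pos, symmetric])
    also have "\<dots> = (\<Prod>c\<in>D. x (T c))"
      by (intro prod.cong arg_cong[of _ _ x] w refl)
    finally show "prod_list (map x ?w) = (\<Prod>c\<in>D. x (T c))" .
  next
    fix w assume w: "w \<in> words K n Q"
    let ?T = "\<lambda>c\<in>D. w ! pos c"
    show "map (\<lambda>p. ?T (inv_into D pos p)) [0..<n] = w"
      using w inv' by (intro nth_equalityI) (auto simp: words_def)
    have "semistandard D ?T \<longleftrightarrow> semistandard D (\<lambda>c. w ! pos c)"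
      by (rule semistandard_cong) simp
    then show "?T \<in> {T \<in> D \<rightarrow>\<^sub>E K. semistandard D T}"
      using w Q inv by (auto simp: words_def subset_iff)
  }
qed

text \<open>A tableau of weight \<mu> uses only letters in the support of \<mu>, so the coefficient
  at \<mu> can be read off from a polynomial over that finite alphabet. The letter 0 is removed
  because entries of tableaux are positive.\<close>

lemma tableau_series_eq_lookup:
  fixes \<mu> :: "nat \<Rightarrow>\<^sub>0 nat"
  assumes D: "finite D"
  shows "tableau_series D \<mu> = Poly_Mapping.lookup
    (tableau_sum (Poly_Mapping.keys \<mu> - {0})
       (\<lambda>m. Poly_Mapping.single (Poly_Mapping.single m 1) (1::int)) D) \<mu>"
proof -
  let ?K = "Poly_Mapping.keys \<mu> - {0}"
  let ?X = "\<lambda>m::nat. Poly_Mapping.single (Poly_Mapping.single m (1::nat)) (1::int)"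
  let ?\<S> = "{T \<in> D \<rightarrow>\<^sub>E ?K. semistandard D T}"
  have prod: "(\<Prod>c\<in>C. ?X (T c)) =
      Poly_Mapping.single (\<Sum>c\<in>C. Poly_Mapping.single (T c) 1) 1" if "finite C"
    for C :: "cell set" and T
    using that by induction (simp_all add: mult_single)
  have lookup: "Poly_Mapping.lookup (\<Sum>c\<in>D. Poly_Mapping.single (T c) 1) m = card {c \<in> D. T c = m}"
    for T :: "cell \<Rightarrow> nat" and m
    using D by (simp add: lookup_sum lookup_single when_def flip: sum.inter_filter)
  have weight: "(\<Sum>c\<in>D. Poly_Mapping.single (T c) 1) = \<mu> \<longleftrightarrow>
      (\<forall>m. Poly_Mapping.lookup \<mu> m = card {c \<in> D. T c = m})" for T :: "cell \<Rightarrow> nat"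
    by (auto simp: poly_mapping_eq_iff fun_eq_iff lookup simp del: One_nat_def)
  have "finite (D \<rightarrow>\<^sub>E ?K)"
    using D by (simp add: finite_PiE)
  then have fin: "finite ?\<S>"
    by (rule rev_finite_subset) blast
  have "ssyt_of_weight D \<mu> =
      {T \<in> ?\<S>. \<forall>m. Poly_Mapping.lookup \<mu> m = card {c \<in> D. T c = m}}"
  proof (intro equalityI subsetI)
    fix T assume T: "T \<in> ssyt_of_weight D \<mu>"
    have "T c \<in> ?K" if c: "c \<in> D" for c
    proof -
      have "{c' \<in> D. T c' = T c} \<noteq> {}"
        using c by blast
      then have "card {c' \<in> D. T c' = T c} \<noteq> 0"
        using D by (simp del: Collect_empty_eq)
      moreover have "T c \<ge> 1"
        using T c by (auto simp: ssyt_of_weight_def ssyt_def)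
      ultimately show ?thesis
        using T by (auto simp: ssyt_of_weight_def in_keys_iff)
    qed
    then show "T \<in> {T \<in> ?\<S>. \<forall>m. Poly_Mapping.lookup \<mu> m = card {c \<in> D. T c = m}}"
      using T by (auto simp: ssyt_of_weight_def ssyt_iff PiE_iff)
  next
    fix T assume "T \<in> {T \<in> ?\<S>. \<forall>m. Poly_Mapping.lookup \<mu> m = card {c \<in> D. T c = m}}"
    then show "T \<in> ssyt_of_weight D \<mu>"
      by (auto simp: ssyt_of_weight_def ssyt_iff PiE_iff Suc_le_eq)
  qed
  then have "tableau_series D \<mu> =
      (\<Sum>T\<in>?\<S>. if (\<Sum>c\<in>D. Poly_Mapping.single (T c) 1) = \<mu> then 1 else 0)"
    using fin by (simp add: tableau_series_def weight del: One_nat_def flip: sum.inter_filter)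
  then show ?thesis
    using D by (simp add: tableau_sum_def prod lookup_sum lookup_single when_def eq_commute[of \<mu>]
        del: One_nat_def)
qed

text \<open>A new top row of length \<open>n\<close> starting in column \<open>l\<close>, with \<open>D\<close> moved down by one. In the reading word
  the new row follows the \<open>s\<close> letters of \<open>D\<close>.\<close>

definition stack :: "nat \<Rightarrow> nat \<Rightarrow> cell set \<Rightarrow> cell set" where
  "stack l n D = {(i, j). case i of 0 \<Rightarrow> l \<le> j \<and> j < l + n | Suc i' \<Rightarrow> (i', j) \<in> D}"

fun stack_pos :: "nat \<Rightarrow> nat \<Rightarrow> (cell \<Rightarrow> nat) \<Rightarrow> cell \<Rightarrow> nat" where
  "stack_pos l s pos (0, j) = s + (j - l)"
| "stack_pos l s pos (Suc i, j) = pos (i, j)"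

lemma mem_stack [simp]:
  "(0, j) \<in> stack l n D \<longleftrightarrow> l \<le> j \<and> j < l + n"
  "(Suc i, j) \<in> stack l n D \<longleftrightarrow> (i, j) \<in> D"
  by (simp_all add: stack_def)

lemma bij_betw_stack_pos:
  assumes "bij_betw pos D {..<s}"
  shows "bij_betw (stack_pos l s pos) (stack l n D) {..<s + n}"
proof -
  let ?shift = "\<lambda>(i, j). (Suc i, j :: nat)"
  have stack: "stack l n D = Pair 0 ` {l..<l + n} \<union> ?shift ` D"
  proof (rule set_eqI)
    fix c :: cell
    obtain i j where "c = (i, j)" by (cases c)
    then show "c \<in> stack l n D \<longleftrightarrow> c \<in> Pair 0 ` {l..<l + n} \<union> ?shift ` D"
      by (cases i) (auto simp: image_iff intro!: bexI[of _ "(i - 1, j)"])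
  qed
  have ivl: "{s..<s + n} \<union> {..<s} = {..<s + n}" "{s..<s + n} \<inter> {..<s} = {}"
    by auto
  have top: "bij_betw (stack_pos l s pos) (Pair 0 ` {l..<l + n}) {s..<s + n}"
    by (rule bij_betw_byWitness[where f' = "\<lambda>p. (0, p - s + l)"]) (auto intro!: imageI)
  have bottom: "bij_betw (stack_pos l s pos) (?shift ` D) {..<s}"
  proof (rule bij_betw_imageI)
    show "inj_on (stack_pos l s pos) (?shift ` D)"
      using bij_betw_imp_inj_on[OF assms] by (auto intro!: inj_onI dest: inj_onD)
    have "stack_pos l s pos ` ?shift ` D = pos ` D"
      by (simp add: image_image case_prod_unfold)
    then show "stack_pos l s pos ` ?shift ` D = {..<s}"
      using assms by (simp add: bij_betw_def)
  qed
  show ?thesis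
    using bij_betw_combine[OF top bottom ivl(2)] by (simp only: stack ivl(1))
qed

lemma mono_of_steps:
  fixes g :: "nat \<Rightarrow> nat"
  assumes "\<And>p. Suc p < n \<Longrightarrow> g p \<le> g (Suc p)" and "p \<le> q" and "q < n"
  shows "g p \<le> g q"
  using assms(2,3)
proof (induction q rule: dec_induct)
  case (step q)
  then show ?case
    using assms(1)[of q] by simp
qed simp

text \<open>The conditions split into those inside the new row, those inside \<open>D\<close>, and
  those on columns between them. The row is tested on neighbours only, as in a pattern; the column
  condition still involves every cell of \<open>D\<close> below the row and is thinned out
  separately for ribbons and hooks.\<close>

lemma semistandard_stack:
  "semistandard (stack l n D) (\<lambda>c. f (stack_pos l s pos c)) \<longleftrightarrow>
     (\<forall>p. Suc p < n \<longrightarrow> f (s + p) \<le> f (Suc (s + p))) \<and>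
     semistandard D (\<lambda>c. f (pos c)) \<and>
     (\<forall>i j. (i, j) \<in> D \<longrightarrow> l \<le> j \<longrightarrow> j < l + n \<longrightarrow> f (s + (j - l)) < f (pos (i, j)))"
    (is "?L \<longleftrightarrow> ?row \<and> ?D \<and> ?col")
proof
  assume L: ?L
  then have rows: "\<And>i j j'. (i, j) \<in> stack l n D \<Longrightarrow> (i, j') \<in> stack l n D \<Longrightarrow> j < j' \<Longrightarrow>
      f (stack_pos l s pos (i, j)) \<le> f (stack_pos l s pos (i, j'))"
    and cols: "\<And>i i' j. (i, j) \<in> stack l n D \<Longrightarrow> (i', j) \<in> stack l n D \<Longrightarrow> i < i' \<Longrightarrow>
      f (stack_pos l s pos (i, j)) < f (stack_pos l s pos (i', j))"
    unfolding semistandard_def by blast+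
  have ?row
  proof (intro allI impI)
    fix p assume "Suc p < n"
    then show "f (s + p) \<le> f (Suc (s + p))"
      using rows[of 0 "l + p" "Suc (l + p)"] by (simp add: Suc_diff_le)
  qed
  moreover have ?D
    unfolding semistandard_def
  proof (intro conjI allI impI)
    show "f (pos (i, j)) \<le> f (pos (i, j'))" if "(i, j) \<in> D" "(i, j') \<in> D" "j < j'" for i j j'
      using rows[of "Suc i" j j'] that by simp
    show "f (pos (i, j)) < f (pos (i', j))" if "(i, j) \<in> D" "(i', j) \<in> D" "i < i'" for i i' j
      using cols[of "Suc i" j "Suc i'"] that by simp
  qed
  moreover have ?col
  proof (intro allI impI)
    show "f (s + (j - l)) < f (pos (i, j))" if "(i, j) \<in> D" "l \<le> j" "j < l + n" for i j
      using cols[of 0 j "Suc i"] that by simp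
  qed
  ultimately show "?row \<and> ?D \<and> ?col" by blast
next
  assume R: "?row \<and> ?D \<and> ?col"
  then have rows: "\<And>i j j'. (i, j) \<in> D \<Longrightarrow> (i, j') \<in> D \<Longrightarrow> j < j' \<Longrightarrow> f (pos (i, j)) \<le> f (pos (i, j'))"
    and cols: "\<And>i i' j. (i, j) \<in> D \<Longrightarrow> (i', j) \<in> D \<Longrightarrow> i < i' \<Longrightarrow> f (pos (i, j)) < f (pos (i', j))"
    unfolding semistandard_def by blast+
  show ?L
    unfolding semistandard_def
  proof (intro conjI allI impI)
    fix i j j'
    assume c: "(i, j) \<in> stack l n D" "(i, j') \<in> stack l n D" "j < j'"
    show "f (stack_pos l s pos (i, j)) \<le> f (stack_pos l s pos (i, j'))"
    proof (cases i)
      case 0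
      have "f (s + (j - l)) \<le> f (s + (j' - l))"
        by (rule mono_of_steps[of n "\<lambda>p. f (s + p)"]) (use R c 0 in auto)
      then show ?thesis by (simp add: 0)
    next
      case (Suc i')
      then show ?thesis using rows c by simp
    qed
  next
    fix i i' j
    assume c: "(i, j) \<in> stack l n D" "(i', j) \<in> stack l n D" "i < i'"
    then obtain k where k: "i' = Suc k"
      by (cases i') auto
    show "f (stack_pos l s pos (i, j)) < f (stack_pos l s pos (i', j))"
      using c R cols k by (cases i) auto
  qed
qed

section \<open>Ribbons\<close>

text \<open>The index of a cell in the reading word. The top row is read last, hence the offset
  \<open>sum_list \<alpha>\<close>.\<close>

fun ribbon_pos :: "nat list \<Rightarrow> cell \<Rightarrow> nat" where
  "ribbon_pos [] = (\<lambda>_. 0)"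
| "ribbon_pos (n # \<alpha>) = stack_pos (ribbon_left (n # \<alpha>) 0) (sum_list \<alpha>) (ribbon_pos \<alpha>)"

text \<open>The head of the list is the top row and therefore contributes the end of the pattern.
  The \<open>True\<close> before it compares the right end of the row below with the left end of the
  top row, which lies directly above it.\<close>

fun ribbon_pattern :: "nat list \<Rightarrow> bool list" where
  "ribbon_pattern [] = []"
| "ribbon_pattern (n # \<alpha>) =
     (if \<alpha> = [] then [] else ribbon_pattern \<alpha> @ [True]) @ replicate (n - 1) False"

lemma ribbon_left_Cons_0: "ribbon_left (n # \<alpha>) 0 = (\<Sum>k<length \<alpha>. \<alpha> ! k - 1)"
proof -
  have "{0<..<Suc (length \<alpha>)} = Suc ` {..<length \<alpha>}"
    by (auto simp: image_iff gr0_conv_Suc)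
  then show ?thesis
    by (simp add: ribbon_left_def sum.reindex)
qed

lemma ribbon_left_Cons_Suc: "ribbon_left (n # \<alpha>) (Suc i) = ribbon_left \<alpha> i"
proof -
  have "{Suc i<..<Suc (length \<alpha>)} = Suc ` {i<..<length \<alpha>}"
    by (auto simp: image_iff Suc_less_eq2)
  then show ?thesis
    by (simp add: ribbon_left_def sum.reindex)
qed

lemma ribbon_diagram_Cons:
  "ribbon_diagram (n # \<alpha>) = stack (ribbon_left (n # \<alpha>) 0) n (ribbon_diagram \<alpha>)"
proof (rule set_eqI)
  fix c :: cell
  obtain i j where "c = (i, j)" by (cases c)
  then show "c \<in> ribbon_diagram (n # \<alpha>) \<longleftrightarrow>
      c \<in> stack (ribbon_left (n # \<alpha>) 0) n (ribbon_diagram \<alpha>)"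
    by (cases i) (simp_all add: ribbon_diagram_def ribbon_left_Cons_Suc)
qed

lemma bij_betw_ribbon_pos: "bij_betw (ribbon_pos \<alpha>) (ribbon_diagram \<alpha>) {..<sum_list \<alpha>}"
proof (induction \<alpha>)
  case Nil
  then show ?case by (simp add: ribbon_diagram_def bij_betw_def)
next
  case (Cons n \<alpha>)
  then show ?case
    using bij_betw_stack_pos[OF Cons] by (simp add: ribbon_diagram_Cons add.commute)
qed

lemma length_ribbon_pattern:
  assumes "\<alpha> \<noteq> []" and "\<forall>n\<in>set \<alpha>. n \<ge> 1"
  shows "Suc (length (ribbon_pattern \<alpha>)) = sum_list \<alpha>"
  using assms by (induction \<alpha>) auto

text \<open>The new top row starts in the last column of the ribbon below, so the two share at most
  that column.\<close>

lemma ribbon_column_le: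
  assumes "(i, j) \<in> ribbon_diagram \<alpha>"
  shows "j \<le> ribbon_left (n # \<alpha>) 0"
proof -
  have ij: "i < length \<alpha>" "j < ribbon_left \<alpha> i + \<alpha> ! i"
    using assms by (auto simp: ribbon_diagram_def)
  then have "j \<le> (\<Sum>k\<in>insert i {i<..<length \<alpha>}. \<alpha> ! k - 1)"
    by (simp add: ribbon_left_def)
  also have "\<dots> \<le> (\<Sum>k<length \<alpha>. \<alpha> ! k - 1)"
    by (rule sum_mono2) (use ij in auto)
  finally show ?thesis
    by (simp add: ribbon_left_Cons_0)
qed

text \<open>By induction on the rows: since a new row meets the rest in one column only, all its
  column conditions amount to a single descent, from the last letter of the old word to the first
  letter of the new row.\<close>

lemma semistandard_ribbon:
  assumes "\<forall>n\<in>set \<alpha>. n \<ge> 1"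
  shows "semistandard (ribbon_diagram \<alpha>) (\<lambda>c. f (ribbon_pos \<alpha> c)) \<longleftrightarrow> fits (ribbon_pattern \<alpha>) f"
  using assms
proof (induction \<alpha>)
  case Nil
  then show ?case by (simp add: ribbon_diagram_def semistandard_def fits_def)
next
  case (Cons n \<alpha>)
  let ?L = "ribbon_left (n # \<alpha>) 0"
  let ?s = "sum_list \<alpha>"
  have stack: "semistandard (ribbon_diagram (n # \<alpha>)) (\<lambda>c. f (ribbon_pos (n # \<alpha>) c)) \<longleftrightarrow>
      (\<forall>p. Suc p < n \<longrightarrow> f (?s + p) \<le> f (Suc (?s + p))) \<and>
      semistandard (ribbon_diagram \<alpha>) (\<lambda>c. f (ribbon_pos \<alpha> c)) \<and>
      (\<forall>i j. (i, j) \<in> ribbon_diagram \<alpha> \<longrightarrow> ?L \<le> j \<longrightarrow> j < ?L + n \<longrightarrow>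
        f (?s + (j - ?L)) < f (ribbon_pos \<alpha> (i, j)))"
    by (simp only: ribbon_diagram_Cons ribbon_pos.simps semistandard_stack)
  show ?case
  proof (cases \<alpha>)
    case Nil
    then show ?thesis
      unfolding stack
      by (auto simp: ribbon_diagram_def semistandard_def fits_replicate_False)
  next
    case (Cons m \<beta>)
    have m: "m \<ge> 1" and n: "n \<ge> 1"
      using Cons.prems Cons by auto
    have len: "Suc (length (ribbon_pattern \<alpha>)) = ?s"
      by (rule length_ribbon_pattern) (use Cons Cons.prems in auto)
    have L: "?L = ribbon_left (m # \<beta>) 0 + (m - 1)"
      unfolding ribbon_left_Cons_0 by (simp add: Cons sum.lessThan_Suc_shift del: sum.lessThan_Suc)
    have corner: "(0, ?L) \<in> ribbon_diagram \<alpha>"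
      using m unfolding L by (simp add: Cons ribbon_diagram_Cons)
    have pos_corner: "ribbon_pos \<alpha> (0, ?L) = ?s - 1"
      using m unfolding L by (simp add: Cons)
    have "semistandard (ribbon_diagram \<alpha>) (\<lambda>c. f (ribbon_pos \<alpha> c)) \<Longrightarrow>
      (\<forall>i j. (i, j) \<in> ribbon_diagram \<alpha> \<longrightarrow> ?L \<le> j \<longrightarrow> j < ?L + n \<longrightarrow>
        f (?s + (j - ?L)) < f (ribbon_pos \<alpha> (i, j))) \<longleftrightarrow> f ?s < f (?s - 1)"
      (is "?semi \<Longrightarrow> ?col \<longleftrightarrow> _")
    proof
      assume ?col
      from this[rule_format, OF corner] show "f ?s < f (?s - 1)"
        using n by (simp add: pos_corner)
    next
      assume semi: ?semi and less: "f ?s < f (?s - 1)"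
      show ?col
      proof (intro allI impI)
        fix i j assume ij: "(i, j) \<in> ribbon_diagram \<alpha>" "?L \<le> j"
        then have j: "j = ?L"
          using ribbon_column_le[of i j \<alpha> n] by simp
        \<comment> \<open>The shared column may contain further cells below the corner, but their
          entries exceed that of the corner.\<close>
        have "f (ribbon_pos \<alpha> (0, ?L)) \<le> f (ribbon_pos \<alpha> (i, ?L))"
        proof (cases "i = 0")
          case False
          then show ?thesis
            using semi corner ij j unfolding semistandard_def by (simp add: less_imp_le)
        qed simp
        then show "f (?s + (j - ?L)) < f (ribbon_pos \<alpha> (i, j))"
          using less by (simp add: j pos_corner)
      qed
    qed
    moreover have "fits (ribbon_pattern (n # \<alpha>)) f \<longleftrightarrow>
        fits (ribbon_pattern \<alpha>) f \<and> f ?s < f (?s - 1) \<and>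
        (\<forall>p. Suc p < n \<longrightarrow> f (?s + p) \<le> f (Suc (?s + p)))"
    proof -
      have "ribbon_pattern (n # \<alpha>) = ribbon_pattern \<alpha> @ True # replicate (n - 1) False"
        by (simp add: Cons)
      then show ?thesis
        by (simp add: fits_append_Cons fits_replicate_False step_def less_diff_conv conj_ac
            flip: len del: ribbon_pattern.simps)
    qed
    moreover have "semistandard (ribbon_diagram \<alpha>) (\<lambda>c. f (ribbon_pos \<alpha> c)) \<longleftrightarrow>
        fits (ribbon_pattern \<alpha>) f"
      using Cons.IH Cons.prems by simp
    ultimately show ?thesis
      unfolding stack by blast
  qed
qed

lemma tableau_sum_ribbon:
  assumes "\<alpha> \<noteq> []" and "\<forall>n\<in>set \<alpha>. n \<ge> 1"
  shows "tableau_sum K x (ribbon_diagram \<alpha>) = pattern_sum K x (ribbon_pattern \<alpha>)"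
  unfolding pattern_sum_def length_ribbon_pattern[OF assms]
  by (rule tableau_sum_words[OF bij_betw_ribbon_pos semistandard_ribbon[OF assms(2)]])

section \<open>Patterns of ribbons containing a run of ones\<close>

lemma ribbon_pattern_ones_append:
  "\<beta> \<noteq> [] \<Longrightarrow> ribbon_pattern (replicate d 1 @ \<beta>) = ribbon_pattern \<beta> @ replicate d True"
  by (induction d) (auto simp: replicate_append_same)

text \<open>The word of a hook climbs the first column from the bottom, descending strictly, and
  then runs along the top row.\<close>

lemma ribbon_pattern_hook:
  "ribbon_pattern (b # replicate d 1) = replicate d True @ replicate (b - 1) False"
proof (cases d)
  case (Suc d')
  have "ribbon_pattern (replicate d' 1 @ [1]) = replicate d' True"
    by (subst ribbon_pattern_ones_append) simp_all
  then have ones: "ribbon_pattern (replicate d 1) = replicate d' True"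
    by (simp only: Suc replicate_Suc replicate_append_same)
  have "ribbon_pattern (b # replicate d 1) =
      (ribbon_pattern (replicate d 1) @ [True]) @ replicate (b - 1) False"
    by (simp add: Suc)
  then show ?thesis
    unfolding ones by (simp add: Suc replicate_append_same del: ribbon_pattern.simps)
qed simp

section \<open>Swapping tails\<close>

text \<open>Here \<open>e\<close> is the leg and \<open>n\<close> the arm; the corner is the letter
  at position \<open>e\<close>.\<close>

definition hook_words :: "nat set \<Rightarrow> nat \<Rightarrow> nat \<Rightarrow> nat list set" where
  "hook_words K e n = words K (Suc (e + n)) (fits (replicate e True @ replicate n False))"

text \<open>Stated without a pattern, so that the empty row is included.\<close>

definition row_words :: "nat set \<Rightarrow> nat \<Rightarrow> nat list set" where
  "row_words K m = words K m (\<lambda>f. \<forall>p. Suc p < m \<longrightarrow> f p \<le> f (Suc p))"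

text \<open>A row \<open>X\<close> is placed above the row of the hook word \<open>z\<close>, which starts at position \<open>e\<close> of \<open>z\<close>.
  Index \<open>j\<close> crosses if column \<open>j\<close> is not strictly increasing; running past the end of \<open>X\<close> counts
  as a crossing, as if \<open>X\<close> were continued by infinite entries.\<close>

definition crosses :: "nat \<Rightarrow> nat list \<Rightarrow> nat list \<Rightarrow> nat \<Rightarrow> bool" where
  "crosses e z X j \<longleftrightarrow>
     e + j < length z \<and> j \<le> length X \<and> (j < length X \<longrightarrow> z ! (e + j) \<le> X ! j)"

text \<open>The hook word is cut after column \<open>j\<close> but the row before it, so the arm
  length and the row length change places.\<close>

definition swap_tails :: "nat \<Rightarrow> nat list \<times> nat list \<Rightarrow> nat list \<times> nat list" where
  "swap_tails e = (\<lambda>(z, X). let j = LEAST j. crosses e z X j in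
     (take (Suc (e + j)) z @ drop j X, take j X @ drop (Suc (e + j)) z))"

definition crossing_pairs :: "nat set \<Rightarrow> nat \<Rightarrow> nat \<Rightarrow> nat \<Rightarrow> (nat list \<times> nat list) set" where
  "crossing_pairs K e m n =
     {(z, X). z \<in> hook_words K e n \<and> X \<in> row_words K m \<and> (\<exists>j. crosses e z X j)}"

text \<open>The crossing at \<open>j\<close> makes the new hook word weakly increase at its join;
  the failure to cross at \<open>j - 1\<close> does the same for the new row. Columns before
  \<open>j\<close> are untouched and \<open>j\<close> crosses again, so a second swap cuts at the
  same place.\<close>

lemma swap_tails_involution:
  assumes "(z, X) \<in> crossing_pairs K e m n" and "swap_tails e (z, X) = (z', X')"
  shows "(z', X') \<in> crossing_pairs K e n m" and "swap_tails e (z', X') = (z, X)"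
proof -
  define j where "j = (LEAST j. crosses e z X j)"
  have z: "length z = Suc (e + n)" "set z \<subseteq> K"
      "\<And>p. p < e \<Longrightarrow> z ! Suc p < z ! p"
      "\<And>p. e \<le> p \<Longrightarrow> p < e + n \<Longrightarrow> z ! p \<le> z ! Suc p"
    and X: "length X = m" "set X \<subseteq> K" "\<And>p. Suc p < m \<Longrightarrow> X ! p \<le> X ! Suc p"
    and ex: "\<exists>j. crosses e z X j"
    using assms(1)
    by (auto simp: crossing_pairs_def hook_words_def row_words_def words_def fits_hook
        dest: spec split: if_splits)
  have "crosses e z X j"
    unfolding j_def using ex by (rule LeastI_ex)
  then have j: "j \<le> n" "j \<le> m" "j < m \<Longrightarrow> z ! (e + j) \<le> X ! j"
    by (auto simp: crosses_def z X)
  have before: "X ! i < z ! (e + i)" if "i < j" for i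
  proof -
    have "\<not> crosses e z X i"
      using not_less_Least[of i "crosses e z X"] that by (simp add: j_def)
    then show ?thesis
      using that j by (simp add: crosses_def z X)
  qed
  have z': "z' = take (Suc (e + j)) z @ drop j X" and X': "X' = take j X @ drop (Suc (e + j)) z"
    using assms(2) by (simp_all add: swap_tails_def j_def Let_def)
  have len: "length z' = Suc (e + m)" "length X' = n"
    using j by (simp_all add: z' X' z X)
  have set: "set z' \<subseteq> K" "set X' \<subseteq> K"
    using z(2) X(2) by (auto simp: z' X' dest: in_set_takeD in_set_dropD)
  have nth_z': "z' ! p = (if p \<le> e + j then z ! p else X ! (p - Suc e))" if "p \<le> e + m" for p
    using j that by (auto simp: z' z X nth_append)
  have nth_X': "X' ! p = (if p < j then X ! p else z ! Suc (e + p))" if "p < n" for p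
    using j that by (auto simp: X' z X nth_append)
  have "z' \<in> hook_words K e m"
  proof -
    have "if p < e then z' ! Suc p < z' ! p else z' ! p \<le> z' ! Suc p" if p: "p < e + m" for p
    proof -
      consider "p < e + j" | "p = e + j" | "e + j < p" by linarith
      then show ?thesis
      proof cases
        case 1
        then show ?thesis using p j z(3,4)[of p] by (simp add: nth_z')
      next
        case 2
        then show ?thesis using p j by (simp add: nth_z')
      next
        case 3
        then show ?thesis using p X(3)[of "p - Suc e"] by (simp add: nth_z' Suc_diff_Suc)
      qed
    qed
    then show ?thesis
      by (simp add: hook_words_def words_def fits_hook len set)
  qed
  moreover have "X' \<in> row_words K n"
  proof -
    have "X' ! p \<le> X' ! Suc p" if p: "Suc p < n" for p
    proof -
      consider "Suc p < j" | "Suc p = j" | "j \<le> p" by linarith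
      then show ?thesis
      proof cases
        case 1
        then show ?thesis using p j X(3)[of p] by (simp add: nth_X')
      next
        case 2
        \<comment> \<open>The join of the new row: \<open>p = j - 1\<close> precedes the first
          crossing, and the row of the hook increases from there on.\<close>
        then have "X ! p < z ! (e + p)"
          by (intro before) simp
        also have "\<dots> \<le> z ! Suc (e + p)"
          using p by (intro z(4)) auto
        also have "\<dots> \<le> z ! Suc (e + Suc p)"
          using p z(4)[of "Suc (e + p)"] by simp
        finally show ?thesis using p 2 by (auto simp: nth_X')
      next
        case 3
        then show ?thesis using p z(4)[of "Suc (e + p)"] by (simp add: nth_X')
      qed
    qed
    then show ?thesis
      by (simp add: row_words_def words_def len set)
  qed
  \<comment> \<open>In column \<open>j\<close> the new row has the letter following
    \<open>z ! (e + j)\<close> in the old hook row; if \<open>j = n\<close> the new row ends there,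
    which also counts as a crossing.\<close>
  moreover have crosses': "crosses e z' X' j"
    using j z(4)[of "e + j"] by (auto simp: crosses_def len nth_z' nth_X')
  ultimately show "(z', X') \<in> crossing_pairs K e n m"
    by (auto simp: crossing_pairs_def)
  have "(LEAST j. crosses e z' X' j) = j"
  proof (rule Least_equality[where P = "crosses e z' X'", OF crosses'])
    fix i assume i: "crosses e z' X' i"
    show "j \<le> i"
    proof (rule ccontr)
      assume "\<not> j \<le> i"
      then show False
        using i j before[of i] by (simp add: crosses_def len nth_z' nth_X')
    qed
  qed
  then show "swap_tails e (z', X') = (z, X)"
    using j by (simp add: swap_tails_def Let_def z' X' z X)
qed

lemma swap_tails_weight:
  fixes x :: "nat \<Rightarrow> 'r::comm_ring_1"
  assumes "swap_tails e (z, X) = (z', X')"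
  shows "prod_list (map x z') * prod_list (map x X') = prod_list (map x z) * prod_list (map x X)"
proof -
  have split: "prod_list (map x w) = prod_list (map x (take k w)) * prod_list (map x (drop k w))"
    for k w
    by (metis append_take_drop_id map_append prod_list.append)
  define j where "j = (LEAST j. crosses e z X j)"
  have "z' = take (Suc (e + j)) z @ drop j X" and "X' = take j X @ drop (Suc (e + j)) z"
    using assms by (simp_all add: swap_tails_def j_def Let_def)
  then show ?thesis
    unfolding split[of z "Suc (e + j)"] split[of X j] by (simp add: mult_ac)
qed

lemma sum_crossing_pairs_swap:
  fixes x :: "nat \<Rightarrow> 'r::comm_ring_1"
  shows "(\<Sum>(z, X)\<in>crossing_pairs K e m n. prod_list (map x z) * prod_list (map x X)) =
    (\<Sum>(z, X)\<in>crossing_pairs K e n m. prod_list (map x z) * prod_list (map x X))"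
proof -
  have involution: "swap_tails e (swap_tails e p) = p" "swap_tails e p \<in> crossing_pairs K e l k"
    if "p \<in> crossing_pairs K e k l" for p k l
    using that swap_tails_involution by (metis surj_pair)+
  show ?thesis
  proof (rule sum.reindex_bij_witness[of _ "swap_tails e" "swap_tails e"])
    show "(case swap_tails e p of (z, X) \<Rightarrow> prod_list (map x z) * prod_list (map x X)) =
        (case p of (z, X) \<Rightarrow> prod_list (map x z) * prod_list (map x X))" for p
      using swap_tails_weight by (cases p; cases "swap_tails e p") auto
  qed (rule involution; assumption)+
qed

lemma sum_row_words:
  "m \<ge> 1 \<Longrightarrow> (\<Sum>w\<in>row_words K m. prod_list (map x w)) = pattern_sum K x (replicate (m - 1) False)"
  by (simp add: row_words_def pattern_sum_def fits_replicate_False[abs_def] less_diff_conv)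

lemma sum_hook_words:
  "(\<Sum>w\<in>hook_words K e n. prod_list (map x w)) =
     pattern_sum K x (replicate e True @ replicate n False)"
  by (simp add: hook_words_def pattern_sum_def)

section \<open>The Schur function of a near-hook\<close>

lemma ribbon_left_hook: "ribbon_left (b # replicate d 1) i = 0"
  unfolding ribbon_left_def by (rule sum.neutral) (auto simp: nth_Cons')

lemma hook_column_less:
  assumes "(i, j) \<in> ribbon_diagram (b # replicate d 1)" and "b \<ge> 1"
  shows "j < b"
  using assms unfolding ribbon_diagram_def ribbon_left_hook by (cases i) auto

lemma partition_diagram_hook:
  "partition_diagram (a # b # replicate d 1) = stack 0 a (ribbon_diagram (b # replicate d 1))"
proof -
  have "ribbon_diagram (b # replicate d 1) = partition_diagram (b # replicate d 1)"
    unfolding ribbon_diagram_def ribbon_left_hook by (simp add: partition_diagram_def)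
  moreover have "partition_diagram (a # \<nu>) = stack 0 a (partition_diagram \<nu>)" for \<nu>
  proof (rule set_eqI)
    fix c :: cell
    obtain i j where "c = (i, j)" by (cases c)
    then show "c \<in> partition_diagram (a # \<nu>) \<longleftrightarrow> c \<in> stack 0 a (partition_diagram \<nu>)"
      by (cases i) (simp_all add: partition_diagram_def)
  qed
  ultimately show ?thesis by simp
qed

text \<open>As \<open>b \<le> a\<close>, the top row covers every column of the hook. The hook is
  itself column-strict, so it suffices to compare the top row with the first row of the
  hook.\<close>

lemma semistandard_partition_diagram:
  assumes "b \<le> a" and "b \<ge> 1"
  shows "semistandard (partition_diagram (a # b # replicate d 1))
      (\<lambda>c. f (stack_pos 0 (d + b) (ribbon_pos (b # replicate d 1)) c)) \<longleftrightarrow>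
    fits (replicate d True @ replicate (b - 1) False) f \<and>
    (\<forall>p. Suc p < a \<longrightarrow> f (d + b + p) \<le> f (Suc (d + b + p))) \<and>
    (\<forall>j<b. f (d + b + j) < f (d + j))"
proof -
  let ?H = "b # replicate d 1"
  let ?semi = "semistandard (ribbon_diagram ?H) (\<lambda>c. f (ribbon_pos ?H c))"
  have semi: "?semi \<longleftrightarrow> fits (replicate d True @ replicate (b - 1) False) f"
    using semistandard_ribbon[of ?H f] assms unfolding ribbon_pattern_hook by simp
  have top: "(0, j) \<in> ribbon_diagram ?H \<longleftrightarrow> j < b" for j
    unfolding ribbon_diagram_def ribbon_left_hook by simp
  have pos: "ribbon_pos ?H (0, j) = d + j" for j
    unfolding ribbon_pos.simps ribbon_left_hook by (simp add: sum_list_replicate)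
  have col: "(\<forall>i j. (i, j) \<in> ribbon_diagram ?H \<longrightarrow> j < a \<longrightarrow>
      f (d + b + j) < f (ribbon_pos ?H (i, j))) \<longleftrightarrow> (\<forall>j<b. f (d + b + j) < f (d + j))"
    (is "?col \<longleftrightarrow> ?col'") if ?semi
  proof
    assume c: ?col
    show ?col'
    proof (intro allI impI)
      fix j assume "j < b"
      then show "f (d + b + j) < f (d + j)"
        using c[rule_format, of 0 j] assms by (simp only: top pos)
    qed
  next
    assume c: ?col'
    show ?col
    proof (intro allI impI)
      fix i j assume ij: "(i, j) \<in> ribbon_diagram ?H"
      then have j: "j < b"
        using hook_column_less assms by blast
      have "f (ribbon_pos ?H (0, j)) \<le> f (ribbon_pos ?H (i, j))"
      proof (cases "i = 0")
        case False
        then show ?thesis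
          using that ij top[of j] j unfolding semistandard_def by (simp only: less_imp_le neq0_conv)
      qed simp
      then show "f (d + b + j) < f (ribbon_pos ?H (i, j))"
        using c j by (simp only: pos) (meson less_le_trans)
    qed
  qed
  show ?thesis
    unfolding partition_diagram_hook semistandard_stack semi[symmetric] using col by auto
qed

text \<open>Tableaux are the pairs of a hook and a row without crossing. Swapping tails matches the
  crossing pairs with those of arm \<open>a\<close> and row length \<open>b - 1\<close>, where every
  pair crosses.\<close>

lemma tableau_sum_partition:
  fixes x :: "nat \<Rightarrow> 'r::comm_ring_1"
  assumes K: "finite K" and "b \<le> a" and "b \<ge> 2"
  shows "tableau_sum K x (partition_diagram (a # b # replicate d 1)) =
    pattern_sum K x (replicate d True @ replicate (b - 1) False) *
      pattern_sum K x (replicate (a - 1) False) -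
    pattern_sum K x (replicate d True @ replicate a False) *
      pattern_sum K x (replicate (b - 2) False)"
proof -
  let ?H = "b # replicate d 1"
  let ?wt = "\<lambda>(z, X). prod_list (map x z) * prod_list (map x X)"
  let ?Q = "\<lambda>f. fits (replicate d True @ replicate (b - 1) False) f \<and>
    (\<forall>p. Suc p < a \<longrightarrow> f (d + b + p) \<le> f (Suc (d + b + p))) \<and>
    (\<forall>j<b. f (d + b + j) < f (d + j))"
  let ?all = "hook_words K d (b - 1) \<times> row_words K a"
  let ?good = "{(z, X). length z = d + b \<and> length X = a \<and> set z \<subseteq> K \<and> set X \<subseteq> K \<and> ?Q ((!) (z @ X))}"
  have len: "Suc (d + (b - 1)) = d + b"
    using assms by simp
  have "bij_betw (ribbon_pos ?H) (ribbon_diagram ?H) {..<d + b}"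
    using bij_betw_ribbon_pos[of ?H] by (simp add: sum_list_replicate add.commute del: ribbon_pos.simps)
  then have "bij_betw (stack_pos 0 (d + b) (ribbon_pos ?H)) (partition_diagram (a # ?H)) {..<d + b + a}"
    unfolding partition_diagram_hook by (rule bij_betw_stack_pos)
  then have "tableau_sum K x (partition_diagram (a # ?H)) =
      (\<Sum>w\<in>words K (d + b + a) ?Q. prod_list (map x w))"
    by (rule tableau_sum_words) (rule semistandard_partition_diagram; use assms in simp)
  also have "\<dots> = sum ?wt ?good"
    by (rule sum_words_append)
  also have "?good = ?all - crossing_pairs K d a (b - 1)"
  proof (rule set_eqI)
    fix p :: "nat list \<times> nat list"
    obtain z X where p: "p = (z, X)" by (cases p)
    show "p \<in> ?good \<longleftrightarrow> p \<in> ?all - crossing_pairs K d a (b - 1)"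
    proof (cases "length z = d + b \<and> length X = a")
      case True
      have "fits (replicate d True @ replicate (b - 1) False) ((!) (z @ X)) =
          fits (replicate d True @ replicate (b - 1) False) ((!) z)"
        by (rule fits_cong) (use True assms in \<open>auto simp: nth_append\<close>)
      \<comment> \<open>The clause for running past the end of \<open>X\<close> never applies here,
        since a crossing index is below \<open>b \<le> a\<close>.\<close>
      moreover have "(\<forall>j<b. (z @ X) ! (d + b + j) < (z @ X) ! (d + j)) \<longleftrightarrow>
          \<not> (\<exists>j. crosses d z X j)"
        using True assms by (auto simp: crosses_def nth_append not_le)
      ultimately show ?thesis
        using True assms
        by (auto simp: p crossing_pairs_def hook_words_def row_words_def words_def len nth_append)
    qed (use assms in \<open>auto simp: p hook_words_def row_words_def words_def\<close>)
  qed
  also have "sum ?wt \<dots> = sum ?wt ?all - sum ?wt (crossing_pairs K d a (b - 1))"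
    by (rule sum_diff)
      (use K in \<open>auto simp: crossing_pairs_def hook_words_def row_words_def finite_words\<close>)
  also have "sum ?wt (crossing_pairs K d a (b - 1)) = sum ?wt (crossing_pairs K d (b - 1) a)"
    by (rule sum_crossing_pairs_swap)
  also have "crossing_pairs K d (b - 1) a = hook_words K d a \<times> row_words K (b - 1)"
  proof -
    \<comment> \<open>The row ends at index \<open>b - 1\<close>, while the hook row still has a
      letter there because \<open>b - 1 \<le> a\<close>.\<close>
    have "crosses d z X (b - 1)" if "length z = Suc (d + a)" "length X = b - 1" for z X
      using that assms by (simp add: crosses_def)
    then show ?thesis
      by (fastforce simp: crossing_pairs_def hook_words_def row_words_def words_def)
  qed
  finally show ?thesis
    using assms
    by (simp add: sum_row_words sum_hook_words numeral_2_eq_2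
        flip: sum.cartesian_product sum_product)
qed

section \<open>Differences of ribbon Schur functions\<close>

text \<open>Series are compared coefficient by coefficient, each coefficient with its own finite
  alphabet.\<close>

lemma ribbon_schur_diff_eq_schur:
  assumes "\<alpha> \<noteq> []" "\<forall>n\<in>set \<alpha>. n \<ge> 1" and "\<beta> \<noteq> []" "\<forall>n\<in>set \<beta>. n \<ge> 1"
    and "\<And>K (x :: nat \<Rightarrow> (nat \<Rightarrow>\<^sub>0 nat) \<Rightarrow>\<^sub>0 int). finite K \<Longrightarrow>
      pattern_sum K x (ribbon_pattern \<alpha>) - pattern_sum K x (ribbon_pattern \<beta>) =
      tableau_sum K x (partition_diagram \<nu>)"
  shows "ribbon_schur \<alpha> - ribbon_schur \<beta> = schur \<nu>"
proof
  fix \<mu> :: "nat \<Rightarrow>\<^sub>0 nat"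
  let ?X = "\<lambda>m::nat. Poly_Mapping.single (Poly_Mapping.single m (1::nat)) (1::int)"
  let ?K = "Poly_Mapping.keys \<mu> - {0}"
  have "pattern_sum ?K ?X (ribbon_pattern \<alpha>) - pattern_sum ?K ?X (ribbon_pattern \<beta>) =
      tableau_sum ?K ?X (partition_diagram \<nu>)"
    by (rule assms(5)) simp
  then show "(ribbon_schur \<alpha> - ribbon_schur \<beta>) \<mu> = schur \<nu> \<mu>"
    unfolding ribbon_schur_def schur_def fun_diff_def
      tableau_series_eq_lookup[OF finite_ribbon_diagram]
      tableau_series_eq_lookup[OF finite_partition_diagram]
      tableau_sum_ribbon[OF assms(1,2)] tableau_sum_ribbon[OF assms(3,4)]
    by (simp only: flip: lookup_minus)
qed

section \<open>The five identities between pattern sums\<close>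

context
  fixes K :: "nat set" and x :: "nat \<Rightarrow> 'r::comm_ring_1" and d m n :: nat
  assumes K: "finite K"
begin

private abbreviation "P \<equiv> pattern_sum K x"
private abbreviation "T i \<equiv> replicate i True"
private abbreviation "F i \<equiv> replicate i False"
text \<open>With \<open>a = m + 1\<close> and \<open>b = n + 2\<close> this is the expression for
  the Schur function found in \<open>tableau_sum_partition\<close>.\<close>

private abbreviation "S \<equiv> P (T d @ F (Suc n)) * P (F m) - P (T d @ F (Suc m)) * P (F n)"

private lemmas mult = pattern_sum_mult[OF K, of x]
private lemmas replicate_norm = replicate_app_Cons_same replicate_append_same

private lemma rev_FT: "P (F i @ T j) = P (T j @ F i)"
  using pattern_sum_rev[OF K, of x "T j @ F i"] by simp

private lemma rev_FTF: "P (F i @ T j @ F k) = P (F k @ T j @ F i)"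
  using pattern_sum_rev[OF K, of x "F k @ T j @ F i"] by simp

text \<open>Both product expansions contain \<open>P (F (Suc m) @ T d @ F (Suc n))\<close>, which
  cancels; reversal turns the factor \<open>F (Suc m) @ T d\<close> into a hook.\<close>

lemma pattern_sum_diff_1:
  "P (F m @ T (Suc d) @ F (Suc n)) - P (F (Suc m) @ T (Suc d) @ F n) = S"
  using mult[of "F m" "T d @ F (Suc n)"] mult[of "F (Suc m) @ T d" "F n"]
  by (simp add: replicate_norm rev_FT[of "Suc m", simplified] mult.commute)

text \<open>Cut at the descent between the two long rows: fusing them gives a row of the same length
  on both sides, so the \<open>False\<close> terms cancel.\<close>

lemma pattern_sum_diff_2:
  "P (T d @ F (Suc n) @ True # F m) - P (T d @ F (Suc m) @ True # F n) = S"
proof -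
  have "F (Suc n) @ False # F m = F (Suc m) @ False # F n"
    by (simp add: replicate_norm add.commute flip: replicate_add)
  then show ?thesis
    using mult[of "T d @ F (Suc n)" "F m"] mult[of "T d @ F (Suc m)" "F n"]
    by (simp del: replicate_Suc)
qed

text \<open>Fused rows cancel as before. Cutting off the column of ones then produces
  \<open>P (F n) * P (F m) * P (T d)\<close> on both sides, and hooks remain.\<close>

lemma pattern_sum_diff_3:
  "P (F n @ True # F m @ T (Suc d)) - P (F m @ True # F n @ T (Suc d)) = S"
proof -
  have "P (F n @ False # F m @ T (Suc d)) = P (F m @ False # F n @ T (Suc d))"
    by (rule arg_cong[of _ _ P]) (simp add: replicate_norm add.commute flip: replicate_add append_assoc)
  then have "P (F n @ True # F m @ T (Suc d)) - P (F m @ True # F n @ T (Suc d)) =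
      P (F n) * P (F m @ T (Suc d)) - P (F m) * P (F n @ T (Suc d))"
    using mult[of "F n" "F m @ T (Suc d)"] mult[of "F m" "F n @ T (Suc d)"]
    by (simp del: replicate_Suc)
  moreover have "P (F i @ T (Suc d)) = P (F i) * P (T d) - P (T d @ F (Suc i))" for i
    using mult[of "F i" "T d"] rev_FT[of "Suc i" d] by (simp add: replicate_norm)
  ultimately show ?thesis
    by (simp only:) (simp only: algebra_simps)
qed

text \<open>Split off the last letter, that is, multiply by \<open>P []\<close>. The product terms
  cancel by reversal, and what remains is the first identity.\<close>

lemma pattern_sum_diff_4:
  "P (F n @ T (Suc d) @ F m @ [True]) - P (F m @ T (Suc d) @ F n @ [True]) = S"
proof -
  have "P (F i @ T (Suc d) @ F j @ [True]) =
      P (F i @ T (Suc d) @ F j) * P [] - P (F i @ T (Suc d) @ F (Suc j))" for i j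
    using mult[of "F i @ T (Suc d) @ F j" "[]"] by (simp add: replicate_norm)
  then show ?thesis
    using rev_FTF[of n "Suc d" m] rev_FTF[of n "Suc d" "Suc m"] pattern_sum_diff_1
    by (simp del: replicate_Suc)
qed

text \<open>Split off the bottom row \<open>F k\<close>. The products cancel by reversal; in the
  fused terms the condition on \<open>k\<close> gives rows \<open>F (Suc m)\<close> and
  \<open>F m\<close>, as in the first identity.\<close>

lemma pattern_sum_diff_5:
  assumes "m = Suc (n + k)"
  shows "P (F k @ True # F (Suc n) @ T (Suc d) @ F n) -
    P (F k @ True # F n @ T (Suc d) @ F (Suc n)) = S"
proof -
  have "P (F k @ True # F i @ T (Suc d) @ F j) =
      P (F k) * P (F i @ T (Suc d) @ F j) - P (F (Suc (i + k)) @ T (Suc d) @ F j)" for i j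
  proof -
    have "P (F k @ False # F i @ T (Suc d) @ F j) = P (F (Suc (i + k)) @ T (Suc d) @ F j)"
      by (rule arg_cong[of _ _ P]) (simp add: replicate_norm add.commute flip: replicate_add append_assoc)
    then show ?thesis
      using mult[of "F k" "F i @ T (Suc d) @ F j"] by (simp del: replicate_Suc)
  qed
  then show ?thesis
    using rev_FTF[of n "Suc d" "Suc n"] pattern_sum_diff_1
    by (simp add: assms del: replicate_Suc)
qed

end

theorem theorem3p6:
  fixes a b d :: nat
  assumes "a \<ge> b" and "b \<ge> 2"
  shows
    "ribbon_schur ([b] @ replicate d 1 @ [a]) - ribbon_schur ([b - 1] @ replicate d 1 @ [a + 1])
       = schur ([a, b] @ replicate d 1) \<and>
     ribbon_schur ([a, b] @ replicate d 1) - ribbon_schur ([b - 1, a + 1] @ replicate d 1)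
       = schur ([a, b] @ replicate d 1) \<and>
     ribbon_schur (replicate (d + 1) 1 @ [a, b - 1]) - ribbon_schur (replicate (d + 1) 1 @ [b - 1, a])
       = schur ([a, b] @ replicate d 1) \<and>
     ribbon_schur ([1, a] @ replicate d 1 @ [b - 1]) - ribbon_schur ([1, b - 1] @ replicate d 1 @ [a])
       = schur ([a, b] @ replicate d 1) \<and>
     ribbon_schur ([b - 1] @ replicate d 1 @ [b, a - b + 1])
         - ribbon_schur ([b] @ replicate d 1 @ [b - 1, a - b + 1])
       = schur ([a, b] @ replicate d 1)"
proof -
  obtain n where b: "b = Suc (Suc n)"
    using assms(2) by (metis add_2_eq_Suc le_Suc_ex)
  obtain k where a: "a = b + k"
    using assms(1) le_Suc_ex by blast
  \<comment> \<open>Now \<open>a = m + 1\<close>, \<open>b = n + 2\<close> and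
    \<open>k = a - b\<close>, so all parts become successors and truncated subtraction
    disappears.\<close>
  define m where "m = Suc (n + k)"
  have m: "a = Suc m"
    by (simp add: a b m_def)
  have schur: "tableau_sum K x (partition_diagram ([a, b] @ replicate d 1)) =
      pattern_sum K x (replicate d True @ replicate (Suc n) False) * pattern_sum K x (replicate m False) -
      pattern_sum K x (replicate d True @ replicate (Suc m) False) * pattern_sum K x (replicate n False)"
    if "finite K" for K and x :: "nat \<Rightarrow> (nat \<Rightarrow>\<^sub>0 nat) \<Rightarrow>\<^sub>0 int"
    using tableau_sum_partition[OF that assms, of x d] by (simp add: b m)
  note ones = ribbon_pattern_ones_append
  have pattern_1: "ribbon_pattern ([Suc j] @ replicate d 1 @ [Suc i]) =
      replicate i False @ replicate (Suc d) True @ replicate j False" for i j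
    by (simp add: ones[simplified] replicate_append_same)
  have pattern_2: "ribbon_pattern ([Suc j, Suc i] @ replicate d 1) =
      replicate d True @ replicate i False @ True # replicate j False" for i j
    using ribbon_pattern_hook[of "Suc i" d] by simp
  have pattern_3: "ribbon_pattern (replicate (d + 1) 1 @ [Suc j, Suc i]) =
      replicate i False @ True # replicate j False @ replicate (Suc d) True" for i j
    by (subst ones) simp_all
  have pattern_4: "ribbon_pattern ([1, Suc j] @ replicate d 1 @ [Suc i]) =
      replicate i False @ replicate (Suc d) True @ replicate j False @ [True]" for i j
    using pattern_1[of j i] by simp
  have pattern_5: "ribbon_pattern ([Suc j] @ replicate d 1 @ [Suc i, Suc k]) =
      replicate k False @ True # replicate i False @ replicate (Suc d) True @ replicate j False" for i j
    by (simp add: ones[simplified] replicate_append_same)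
  have b1: "b - 1 = Suc n" and a1: "a + 1 = Suc (Suc m)" and ab1: "a - b + 1 = Suc k"
    by (simp_all add: a b m_def)
  \<comment> \<open>Naming the right-hand side protects it from the rewriting of \<open>a\<close>
    and \<open>b\<close> below.\<close>
  define s where "s = schur ([a, b] @ replicate d 1)"
  have *: "ribbon_schur \<alpha> - ribbon_schur \<beta> = s"
    if "ribbon_pattern \<alpha> = u" and "ribbon_pattern \<beta> = v"
      and "\<And>K (x :: nat \<Rightarrow> (nat \<Rightarrow>\<^sub>0 nat) \<Rightarrow>\<^sub>0 int). finite K \<Longrightarrow> pattern_sum K x u - pattern_sum K x v =
        pattern_sum K x (replicate d True @ replicate (Suc n) False) * pattern_sum K x (replicate m False) -
        pattern_sum K x (replicate d True @ replicate (Suc m) False) * pattern_sum K x (replicate n False)"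
      and "\<alpha> \<noteq> []" "\<forall>n\<in>set \<alpha>. n \<ge> 1" "\<beta> \<noteq> []" "\<forall>n\<in>set \<beta>. n \<ge> 1"
    for \<alpha> \<beta> u v
    unfolding s_def
  proof (rule ribbon_schur_diff_eq_schur)
    fix K :: "nat set" and x :: "nat \<Rightarrow> (nat \<Rightarrow>\<^sub>0 nat) \<Rightarrow>\<^sub>0 int"
    assume "finite K"
    then show "pattern_sum K x (ribbon_pattern \<alpha>) - pattern_sum K x (ribbon_pattern \<beta>) =
        tableau_sum K x (partition_diagram ([a, b] @ replicate d 1))"
      unfolding that(1,2) by (simp only: that(3) schur)
  qed (use that in simp_all)
  show ?thesis
    unfolding s_def[symmetric] b1 a1 ab1 unfolding b m
  proof (intro conjI)
    show "ribbon_schur ([Suc (Suc n)] @ replicate d 1 @ [Suc m]) -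
        ribbon_schur ([Suc n] @ replicate d 1 @ [Suc (Suc m)]) = s"
      by (rule *[OF pattern_1 pattern_1 pattern_sum_diff_1]) auto
    show "ribbon_schur ([Suc m, Suc (Suc n)] @ replicate d 1) -
        ribbon_schur ([Suc n, Suc (Suc m)] @ replicate d 1) = s"
      by (rule *[OF pattern_2 pattern_2 pattern_sum_diff_2]) auto
    show "ribbon_schur (replicate (d + 1) 1 @ [Suc m, Suc n]) -
        ribbon_schur (replicate (d + 1) 1 @ [Suc n, Suc m]) = s"
      by (rule *[OF pattern_3 pattern_3 pattern_sum_diff_3]) auto
    show "ribbon_schur ([1, Suc m] @ replicate d 1 @ [Suc n]) -
        ribbon_schur ([1, Suc n] @ replicate d 1 @ [Suc m]) = s"
      by (rule *[OF pattern_4 pattern_4 pattern_sum_diff_4]) auto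
    show "ribbon_schur ([Suc n] @ replicate d 1 @ [Suc (Suc n), Suc k]) -
        ribbon_schur ([Suc (Suc n)] @ replicate d 1 @ [Suc n, Suc k]) = s"
      by (rule *[OF pattern_5 pattern_5 pattern_sum_diff_5[OF _ m_def]]) auto
  qed
qed

end
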